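(* Let $K$ be a finite field, and let $\mathrm{PGL}_2(K)$ act on the projective line $\mathbf{P}^1 = \mathbf{P}^1(K)$. If $S \subseteq \mathrm{PGL}_2(K)$ is a subset that is sharply transitive on $\mathbf{P}^1$ and $1 \in S$, then $S$ is a subgroup of $\mathrm{PGL}_2(K)$.
   Context: $\mathrm{PGL}_2(K)$ is the group of invertible $2\times 2$ matrices over $K$ modulo nonzero scalars, acting on the left in the usual way on the projective line $\mathbf{P}^1(K)$, whose points are written $(x:y)$ and regarded as column vectors up to nonzero scalars. If a group $G$ acts on a set $\Omega$ on the left, a subset $S \subseteq G$ is called sharply transitive (or regular) on $\Omega$ if for every $x, y \in \Omega$ there is a unique $g \in S$ such that $gx = y$. *)

theory Defs
  imports "HOL-Analysis.Determinants" "HOL-Algebra.Group_Action"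
begin

definition GL2 :: "('a::field^2^2) monoid" where
  "GL2 = \<lparr>carrier = {A. invertible A}, mult = (**), one = mat 1\<rparr>"

definition scalar_matrices :: "('a::field^2^2) set" where
  "scalar_matrices = {mat c | c. c \<noteq> 0}"

definition PGL2 :: "('a::field^2^2) set monoid" where
  "PGL2 = GL2 Mod scalar_matrices"

definition proportional :: "('a::field^2) rel" where
  "proportional = {(v, w). v \<noteq> 0 \<and> w \<noteq> 0 \<and> (\<exists>c. c \<noteq> 0 \<and> w = c *s v)}"

definition projective_line :: "('a::field^2) set set" where
  "projective_line = {v. v \<noteq> 0} // proportional"

text \<open>
  An element \<open>g\<close> of \<open>PGL2\<close> is a coset of matrices and a point \<open>p\<close> of the projective line is a class
  of vectors; the image of \<open>p\<close> under \<open>g\<close> consists of all products of their representatives, see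
  \<open>PGL2_action_class\<close> below. The restriction makes the map extensional,
  as required by \<open>group_action\<close>.
\<close>
definition PGL2_action :: "('a::field^2^2) set \<Rightarrow> ('a^2) set \<Rightarrow> ('a^2) set" where
  "PGL2_action g = (\<lambda>p\<in>projective_line. {A *v v | A v. A \<in> g \<and> v \<in> p})"

definition sharply_transitive :: "('g \<Rightarrow> 'x \<Rightarrow> 'x) \<Rightarrow> 'x set \<Rightarrow> 'g set \<Rightarrow> bool" where
  "sharply_transitive \<phi> \<Omega> S \<longleftrightarrow> (\<forall>x\<in>\<Omega>. \<forall>y\<in>\<Omega>. \<exists>!g. g \<in> S \<and> \<phi> g x = y)"

lemma group_GL2: "group (GL2 :: ('a::field^2^2) monoid)"
proof (rule groupI)
  fix A :: "'a^2^2"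
  assume "A \<in> carrier GL2"
  then obtain B where "A ** B = mat 1" "B ** A = mat 1"
    by (auto simp: GL2_def invertible_def)
  then show "\<exists>B\<in>carrier GL2. B \<otimes>\<^bsub>GL2\<^esub> A = \<one>\<^bsub>GL2\<^esub>"
    by (auto simp: GL2_def invertible_def intro!: bexI[of _ B])
next
  show "\<one>\<^bsub>GL2\<^esub> \<in> carrier (GL2 :: ('a^2^2) monoid)"
    by (auto simp: GL2_def invertible_def intro: exI[of _ "mat 1"])
qed (auto simp: GL2_def invertible_mult matrix_mul_assoc)

lemma mat_mult_vec: "mat c *v v = c *s (v::'a::field^2)"
  by (simp add: vec_eq_iff forall_2 matrix_vector_mult_def sum_2 mat_def)

lemma mat_mult_mat: "mat c ** mat d = (mat (c * d) :: 'a::field^2^2)"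
  by (simp add: vec_eq_iff forall_2 matrix_matrix_mult_def sum_2 mat_def)

lemma mat_mult_commute: "mat c ** A = A ** (mat c :: 'a::field^2^2)"
  by (simp add: vec_eq_iff matrix_matrix_mult_def mat_def if_distrib if_distribR mult.commute
      cong: if_cong)

lemma mat_carrier_GL2: "c \<noteq> 0 \<Longrightarrow> mat c \<in> carrier (GL2 :: ('a::field^2^2) monoid)"
  by (auto simp: GL2_def invertible_def mat_mult_mat intro!: exI[of _ "mat (inverse c)"])

lemma scalar_matrices_normal: "scalar_matrices \<lhd> (GL2 :: ('a::field^2^2) monoid)"
proof -
  interpret group "GL2 :: ('a^2^2) monoid"
    by (rule group_GL2)
  have inv: "inv\<^bsub>GL2\<^esub> (mat c) = (mat (inverse c) :: 'a^2^2)" if "c \<noteq> 0" for c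
  proof (rule inv_equality)
    show "mat (inverse c) \<otimes>\<^bsub>GL2\<^esub> mat c = (\<one>\<^bsub>GL2\<^esub> :: 'a^2^2)"
      using that by (simp add: GL2_def mat_mult_mat)
  qed (use that in \<open>auto intro: mat_carrier_GL2\<close>)
  have "subgroup scalar_matrices (GL2 :: ('a^2^2) monoid)"
  proof (rule subgroupI)
    show "scalar_matrices \<subseteq> carrier (GL2 :: ('a^2^2) monoid)"
      by (auto simp: scalar_matrices_def mat_carrier_GL2)
    show "scalar_matrices \<noteq> ({} :: ('a^2^2) set)"
      by (auto simp: scalar_matrices_def intro: exI[of _ 1])
    show "inv\<^bsub>GL2\<^esub> A \<in> scalar_matrices" if "A \<in> scalar_matrices" for A :: "'a^2^2"
      using that inv by (force simp: scalar_matrices_def)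
    show "A \<otimes>\<^bsub>GL2\<^esub> B \<in> scalar_matrices"
      if "A \<in> scalar_matrices" "B \<in> scalar_matrices" for A B :: "'a^2^2"
      using that by (force simp: scalar_matrices_def GL2_def mat_mult_mat)
  qed
  then show ?thesis
    by (rule normalI)
      (auto simp: r_coset_def l_coset_def scalar_matrices_def GL2_def mat_mult_commute)
qed

lemma group_PGL2: "group (PGL2 :: ('a::field^2^2) set monoid)"
  unfolding PGL2_def by (rule normal.factorgroup_is_group[OF scalar_matrices_normal])

lemma equiv_proportional: "equiv {v. v \<noteq> 0} (proportional :: ('a::field^2) rel)"
proof (rule equivI)
  show "sym (proportional :: ('a^2) rel)"
  proof (rule symI)
    fix v w :: "'a^2"
    assume "(v, w) \<in> proportional"
    then obtain c where "v \<noteq> 0" "w \<noteq> 0" "c \<noteq> 0" "w = c *s v"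
      by (auto simp: proportional_def)
    then show "(w, v) \<in> proportional"
      by (auto simp: proportional_def intro!: exI[of _ "inverse c"])
  qed
  show "trans (proportional :: ('a^2) rel)"
  proof (rule transI)
    fix u v w :: "'a^2"
    assume "(u, v) \<in> proportional" "(v, w) \<in> proportional"
    then obtain c d where "u \<noteq> 0" "w \<noteq> 0" "c \<noteq> 0" "d \<noteq> 0" "v = c *s u" "w = d *s v"
      by (auto simp: proportional_def)
    then show "(u, w) \<in> proportional"
      by (auto simp: proportional_def intro!: exI[of _ "d * c"])
  qed
qed (auto simp: proportional_def refl_on_def intro: exI[of _ 1])

lemma scalar_coset: "scalar_matrices #>\<^bsub>GL2\<^esub> A = {mat c ** A | c. c \<noteq> 0}"
  by (auto simp: r_coset_def scalar_matrices_def GL2_def)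

lemma PGL2_action_class:
  fixes A :: "'a::field^2^2"
  assumes A: "invertible A" and v: "v \<noteq> 0"
  shows "PGL2_action (scalar_matrices #>\<^bsub>GL2\<^esub> A) (proportional `` {v}) = proportional `` {A *v v}"
    and "A *v v \<noteq> 0"
proof -
  have nz: "A *v w \<noteq> 0" if "w \<noteq> 0" for w
    using A that matrix_left_invertible_ker[of A] by (auto simp: invertible_def)
  then show "A *v v \<noteq> 0"
    using v by blast
  have cls: "proportional `` {w} = {c *s w | c. c \<noteq> 0}" if "w \<noteq> 0" for w :: "'a^2"
    using that by (auto simp: proportional_def)
  have prod: "(mat c ** A) *v (d *s v) = (c * d) *s (A *v v)" for c d
    by (simp add: matrix_vector_mul_assoc[symmetric] mat_mult_vec matrix_vector_mult_scaleR
        vector_scalar_commute)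
  have "proportional `` {v} \<in> projective_line"
    using v by (auto simp: projective_line_def intro: quotientI)
  then have "PGL2_action (scalar_matrices #>\<^bsub>GL2\<^esub> A) (proportional `` {v}) =
      {(mat c ** A) *v (d *s v) | c d. c \<noteq> 0 \<and> d \<noteq> 0}"
    by (auto simp: PGL2_action_def scalar_coset cls[OF v])
  also have "\<dots> = {c *s (A *v v) | c. c \<noteq> 0}"
    unfolding prod by (metis (no_types, opaque_lifting) mult.right_neutral mult_eq_0_iff zero_neq_one)
  finally show "PGL2_action (scalar_matrices #>\<^bsub>GL2\<^esub> A) (proportional `` {v}) =
      proportional `` {A *v v}"
    using cls[OF nz[OF v]] by simp
qed

lemma PGL2_cases:
  assumes "g \<in> carrier PGL2"
  obtains A where "invertible A" "g = scalar_matrices #>\<^bsub>GL2\<^esub> A"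
  using assms by (auto simp: PGL2_def carrier_FactGroup GL2_def)

lemma projective_line_cases:
  assumes "p \<in> projective_line"
  obtains v where "v \<noteq> 0" "p = proportional `` {v}"
  using assms by (auto simp: projective_line_def elim: quotientE)

lemma projective_lineI: "v \<noteq> 0 \<Longrightarrow> proportional `` {v} \<in> projective_line"
  by (auto simp: projective_line_def intro: quotientI)

lemma PGL2_action_closed:
  assumes "g \<in> carrier PGL2" "p \<in> projective_line"
  shows "PGL2_action g p \<in> projective_line"
  using assms by (metis PGL2_cases projective_line_cases PGL2_action_class projective_lineI)

lemma PGL2_action_mult:
  assumes g: "g \<in> carrier PGL2" and h: "h \<in> carrier PGL2" and p: "p \<in> projective_line"
  shows "PGL2_action (g \<otimes>\<^bsub>PGL2\<^esub> h) p = PGL2_action g (PGL2_action h p)"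
proof -
  obtain A where A: "invertible A" "g = scalar_matrices #>\<^bsub>GL2\<^esub> A"
    using g by (rule PGL2_cases)
  obtain B where B: "invertible B" "h = scalar_matrices #>\<^bsub>GL2\<^esub> B"
    using h by (rule PGL2_cases)
  obtain v where v: "v \<noteq> 0" "p = proportional `` {v}"
    using p by (rule projective_line_cases)
  have "g \<otimes>\<^bsub>PGL2\<^esub> h = scalar_matrices #>\<^bsub>GL2\<^esub> (A \<otimes>\<^bsub>GL2\<^esub> B)"
    using A B normal.rcos_sum[OF scalar_matrices_normal, of A B] by (simp add: PGL2_def GL2_def)
  then have "g \<otimes>\<^bsub>PGL2\<^esub> h = scalar_matrices #>\<^bsub>GL2\<^esub> (A ** B)"
    by (simp add: GL2_def)
  then show ?thesis
    using A B v by (simp add: PGL2_action_class invertible_mult matrix_vector_mul_assoc)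
qed

lemma PGL2_action_one:
  fixes p :: "('a::field^2) set"
  assumes "p \<in> projective_line"
  shows "PGL2_action \<one>\<^bsub>PGL2\<^esub> p = p"
proof -
  obtain v where v: "v \<noteq> 0" "p = proportional `` {v}"
    using assms by (rule projective_line_cases)
  have "\<one>\<^bsub>PGL2\<^esub> = scalar_matrices #>\<^bsub>GL2\<^esub> (mat 1 :: 'a^2^2)"
    by (simp add: PGL2_def scalar_coset) (simp add: scalar_matrices_def)
  moreover have "invertible (mat 1 :: 'a^2^2)"
    by (auto simp: invertible_def intro: exI[of _ "mat 1"])
  ultimately show ?thesis
    using v PGL2_action_class(1)[of "mat 1" v] by simp
qed

lemma group_action_PGL2:
  "group_action (PGL2 :: ('a::field^2^2) set monoid) projective_line PGL2_action"
proof -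
  interpret group "PGL2 :: ('a^2^2) set monoid"
    by (rule group_PGL2)
  have Bij: "PGL2_action g \<in> Bij projective_line" if g: "g \<in> carrier PGL2" for g :: "('a^2^2) set"
  proof -
    have "bij_betw (PGL2_action g) projective_line projective_line"
    proof (rule bij_betw_byWitness[where f' = "PGL2_action (inv\<^bsub>PGL2\<^esub> g)"])
      show "\<forall>p\<in>projective_line. PGL2_action (inv\<^bsub>PGL2\<^esub> g) (PGL2_action g p) = p"
        using g by (metis PGL2_action_mult PGL2_action_one inv_closed l_inv)
      show "\<forall>p\<in>projective_line. PGL2_action g (PGL2_action (inv\<^bsub>PGL2\<^esub> g) p) = p"
        using g by (metis PGL2_action_mult PGL2_action_one inv_closed r_inv)
    qed (use g in \<open>auto intro: PGL2_action_closed\<close>)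
    then show ?thesis
      by (auto simp: Bij_def PGL2_action_def)
  qed
  have "PGL2_action (g \<otimes>\<^bsub>PGL2\<^esub> h) = compose projective_line (PGL2_action g) (PGL2_action h)"
    if "g \<in> carrier PGL2" "h \<in> carrier PGL2" for g h :: "('a^2^2) set"
  proof (rule extensionalityI)
    show "PGL2_action (g \<otimes>\<^bsub>PGL2\<^esub> h) \<in> extensional projective_line"
      by (simp add: PGL2_action_def)
  qed (use that in \<open>auto simp: compose_eq PGL2_action_mult\<close>)
  then have "PGL2_action \<in> hom (PGL2 :: ('a^2^2) set monoid) (BijGroup projective_line)"
    using Bij by (auto simp: hom_def BijGroup_def)
  then show ?thesis
    by (simp add: group_action_def group_hom_def group_hom_axioms_def group_BijGroup)
qed

end

theory Submission
  imports Defs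
begin

text \<open>
  Represent every element of \<open>S\<close> by a matrix, the identity by the identity matrix, and write
  \<open>[x, y]\<close> for the determinant of the matrix with columns \<open>x, y\<close>. The element \<open>A\<close> maps the point
  \<open>v\<close> to the point \<open>x\<close> iff \<open>[x, A v] = 0\<close>, so sharp transitivity says that the bilinear forms
  \<open>(x, v) \<mapsto> [x, A v]\<close> have the following property: at each pair of nonzero vectors exactly one of
  them vanishes.

  The proof is a product argument in the style of Segre's lemma of tangents. For linearly
  independent \<open>x1, x2\<close> and for \<open>v \<noteq> 0\<close> the ratio \<open>[x1, A v] / [x2, A v]\<close> takes every value of
  \<open>K\<^sup>*\<close> exactly once as \<open>A\<close> varies, apart from the \<open>A\<close> where it is \<open>0\<close> or \<open>\<infinity>\<close>; the
  same holds for \<open>[x, A v1] / [x, A v2]\<close>. Hence the products \<open>P(x, v)\<close> of the nonzero values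
  \<open>[x, A v]\<close> have ratios that are known up to the few exceptional \<open>A\<close> (lemma
  \<open>prod_nonzero_ratio\<close>). Computing the cross ratio of the four numbers
  \<open>P(xi, vj)\<close> by rows and by columns yields an identity between the four elements that
  map \<open>vj\<close> to \<open>xi\<close> (lemma \<open>quadrilateral_relation\<close>).

  Applied to the points \<open>x, C x, B C x\<close>, where the four elements are \<open>A\<close>, \<open>B\<close>, \<open>C\<close> and \<open>1\<close>,
  the identity says: if \<open>A x = \<alpha> B C x\<close> then \<open>det A = \<alpha>\<^sup>2 det (B C)\<close>
  (lemma \<open>det_eq_if_agree_at_point\<close>). In other words, both eigenvalues of \<open>(B C)\<^sup>-\<^sup>1 A\<close>
  equal \<open>\<alpha>\<close>, so this matrix is scalar as soon as it fixes two points. Consequently, if \<open>B C\<close>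
  represented no element of \<open>S\<close>, then distinct points \<open>x\<close> would give distinct elements \<open>A\<close> of \<open>S\<close>
  with \<open>A x = B C x\<close>. As \<open>S\<close> has as many elements as there are points, \<open>A = B\<close> would occur,
  and then \<open>C\<close> would fix a point, which only the identity does. So \<open>S\<close> is closed under
  multiplication. It contains inverses because the element taking \<open>g p\<close> back to \<open>p\<close> has a product
  with \<open>g\<close> that fixes \<open>p\<close>.
\<close>

section \<open>The determinant form on the plane\<close>

definition bracket :: "'a::field^2 \<Rightarrow> 'a^2 \<Rightarrow> 'a" where
  "bracket x y = x$1 * y$2 - x$2 * y$1"

lemma bracket_swap: "bracket y x = - bracket x y"
  by (simp add: bracket_def)

lemma bracket_scale_right [simp]: "bracket x (c *s y) = c * bracket x y"
  by (simp add: bracket_def algebra_simps)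

lemma bracket_scale_left [simp]: "bracket (c *s x) y = c * bracket x y"
  by (simp add: bracket_def algebra_simps)

lemma bracket_add_right: "bracket x (y + z) = bracket x y + bracket x z"
  by (simp add: bracket_def algebra_simps)

lemma bracket_add_left: "bracket (x + y) z = bracket x z + bracket y z"
  by (simp add: bracket_def algebra_simps)

lemma bracket_self [simp]: "bracket x x = 0"
  by (simp add: bracket_def)

lemma bracket_zero_right [simp]: "bracket x 0 = 0"
  by (simp add: bracket_def)

lemma bracket_zero_left [simp]: "bracket 0 x = 0"
  by (simp add: bracket_def)

lemma bracket_eq_0D:
  assumes "bracket x y = 0" and "x \<noteq> 0"
  obtains c where "y = c *s x"
proof (cases "x$1 = 0")
  case True
  then have "x$2 \<noteq> 0"
    using assms(2) by (auto simp: vec_eq_iff forall_2)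
  then have "y = (y$2 / x$2) *s x"
    using assms(1) True by (auto simp: vec_eq_iff forall_2 bracket_def)
  then show thesis by (rule that)
next
  case False
  then have "y = (y$1 / x$1) *s x"
    using assms(1) by (auto simp: vec_eq_iff forall_2 bracket_def field_simps)
  then show thesis by (rule that)
qed

lemma bracket_matrix: "bracket (A *v x) (A *v y) = det A * bracket x y"
  by (simp add: bracket_def det_2 matrix_vector_mult_def sum_2 algebra_simps)

lemma matrix_eq_if_eq_on_basis:
  fixes A B :: "'a::field^2^2"
  assumes ind: "bracket x y \<noteq> 0" and x: "A *v x = B *v x" and y: "A *v y = B *v y"
  shows "A = B"
proof -
  have "A *v v = B *v v" for v
  proof -
    have "v = (bracket v y / bracket x y) *s x + (bracket x v / bracket x y) *s y"
      using ind by (simp add: vec_eq_iff forall_2 field_simps) (simp add: bracket_def algebra_simps)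
    then obtain s t where "v = s *s x + t *s y" by blast
    then show ?thesis
      by (simp add: matrix_vector_right_distrib vector_scalar_commute x y)
  qed
  then show ?thesis by (simp add: matrix_eq)
qed

section \<open>Products of nonzero values in a pencil of functions\<close>

text \<open>
  Apart from the zeros \<open>p\<close> of \<open>F\<close> and \<open>r\<close> of \<open>G\<close>, the quotient \<open>F / G\<close> is a bijection onto the
  nonzero field elements, since \<open>F = c G\<close> has exactly one solution for each \<open>c\<close>. The exceptional
  factors are cross-multiplied so that the equation also holds for \<open>p = r\<close>, when both sides vanish.
\<close>
lemma prod_nonzero_ratio:
  fixes F G :: "'i \<Rightarrow> 'a::{field,finite}"
  assumes fin: "finite I"
    and pencil: "\<And>s t. (s, t) \<noteq> (0, 0) \<Longrightarrow> \<exists>!i. i \<in> I \<and> s * F i + t * G i = 0"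
    and p: "p \<in> I" "F p = 0" and r: "r \<in> I" "G r = 0"
  shows "(\<Prod>i\<in>I. if F i = 0 then 1 else F i) * G p =
    \<Prod>(UNIV - {0}) * (\<Prod>i\<in>I. if G i = 0 then 1 else G i) * F r"
proof (cases "p = r")
  case True
  then show ?thesis using p r by simp
next
  case False
  have F0: "F i = 0 \<longleftrightarrow> i = p" if "i \<in> I" for i
    using pencil[of 1 0] p that by auto
  have G0: "G i = 0 \<longleftrightarrow> i = r" if "i \<in> I" for i
    using pencil[of 0 1] r that by auto
  define J where "J = I - {p, r}"
  have I: "I = insert p (insert r J)" and J: "p \<notin> J" "r \<notin> J" "finite J"
    using p r fin by (auto simp: J_def)
  have J0: "F i \<noteq> 0" "G i \<noteq> 0" "i \<in> I" if "i \<in> J" for i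
    using that F0 G0 by (auto simp: J_def)
  have "bij_betw (\<lambda>i. F i / G i) J (UNIV - {0})"
  proof (rule bij_betwI')
    fix i j assume ij: "i \<in> J" "j \<in> J"
    show "F i / G i = F j / G j \<longleftrightarrow> i = j"
      using pencil[of 1 "- (F i / G i)"] J0[OF ij(1)] J0[OF ij(2)]
      by (auto simp: field_simps)
  next
    fix i assume "i \<in> J"
    then show "F i / G i \<in> UNIV - {0}"
      using J0 by simp
  next
    fix c :: 'a assume "c \<in> UNIV - {0}"
    then obtain i where i: "i \<in> I" "F i = c * G i" and c: "c \<noteq> 0"
      using pencil[of 1 "- c"] by auto
    moreover have "i \<in> J"
      using i c p r F0 G0 False unfolding J_def by (metis DiffI insertE mult_eq_0_iff singletonD)
    ultimately show "\<exists>i\<in>J. c = F i / G i"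
      using J0(2) by (intro bexI[of _ i]) auto
  qed
  then have "(\<Prod>i\<in>J. F i / G i) = \<Prod>(UNIV - {0})"
    using prod.reindex_bij_betw[of "\<lambda>i. F i / G i" J "UNIV - {0}" "\<lambda>x. x"] by simp
  moreover have "(\<Prod>i\<in>J. G i) \<noteq> 0"
    using J0 J by simp
  ultimately have "(\<Prod>i\<in>J. F i) = \<Prod>(UNIV - {0}) * (\<Prod>i\<in>J. G i)"
    by (simp add: prod_dividef field_simps)
  moreover have "(\<Prod>i\<in>J. if F i = 0 then 1 else F i) = (\<Prod>i\<in>J. F i)"
    "(\<Prod>i\<in>J. if G i = 0 then 1 else G i) = (\<Prod>i\<in>J. G i)"
    using J0 by (auto intro!: prod.cong)
  ultimately show ?thesis
    using J False p r F0[of r] G0[of p] unfolding I by simp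
qed

section \<open>Sharply transitive sets of matrices\<close>

text \<open>
  Sets of representatives of sharply transitive subsets of the projective group, with \<open>mat 1\<close>
  itself chosen to represent the identity. Points are replaced by nonzero vectors, and
  \<open>bracket y (A *v x) = 0\<close> expresses that \<open>A\<close> maps the point of \<open>x\<close> to the point of \<open>y\<close>.
\<close>
locale sharply_transitive_matrices =
  fixes T :: "('a::{field,finite}^2^2) set"
  assumes det_nonzero: "A \<in> T \<Longrightarrow> det A \<noteq> 0"
    and sharp: "x \<noteq> 0 \<Longrightarrow> y \<noteq> 0 \<Longrightarrow> \<exists>!A. A \<in> T \<and> bracket y (A *v x) = 0"
    and one: "mat 1 \<in> T"
begin

lemma finite_T: "finite T"
  by simp

lemma independent_images:
  assumes "A \<in> T" "B \<in> T" "A \<noteq> B" "x \<noteq> 0"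
  shows "bracket (A *v x) (B *v x) \<noteq> 0"
proof -
  have "A *v x \<noteq> 0"
    using det_nonzero[OF assms(1)] assms(4) by (metis invertible_det_nz PGL2_action_class(2))
  then show ?thesis
    using sharp[of x "A *v x"] assms by auto
qed

lemma no_fixed_point:
  assumes "A \<in> T" "A \<noteq> mat 1" "x \<noteq> 0"
  shows "bracket x (A *v x) \<noteq> 0"
  using independent_images[OF one assms(1)] assms by auto

text \<open>
  Let \<open>P x v\<close> be the product of the nonzero values of \<open>bracket x (A *v v)\<close>. The quotients
  \<open>P x1 v / P x2 v\<close> and \<open>P x v1 / P x v2\<close> are given by the preceding product formula. Going from
  \<open>P x1 v1\<close> to \<open>P x2 v2\<close> via \<open>P x2 v1\<close> or via \<open>P x1 v2\<close> gives the same result. Either way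
  contributes the product of all nonzero field elements twice, so that it cancels and only the
  exceptional factors remain. Some of the four matrices may coincide.
\<close>
lemma quadrilateral_relation:
  assumes xy: "bracket x1 x2 \<noteq> 0" and v: "bracket v1 v2 \<noteq> 0"
    and T: "A \<in> T" "B \<in> T" "C \<in> T" "D \<in> T"
    and inc: "bracket x1 (A *v v1) = 0" "bracket x1 (B *v v2) = 0"
      "bracket x2 (C *v v1) = 0" "bracket x2 (D *v v2) = 0"
  shows "bracket x1 (A *v v2) * bracket x2 (B *v v2) * bracket x1 (C *v v1) * bracket x2 (D *v v1) =
    bracket x2 (A *v v1) * bracket x1 (B *v v1) * bracket x2 (C *v v2) * bracket x1 (D *v v2)"
proof -
  define P where "P x v = (\<Prod>A\<in>T. if bracket x (A *v v) = 0 then 1 else bracket x (A *v v))"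
    for x v :: "'a^2"
  define w where "w = \<Prod>(UNIV - {0::'a})"
  have w: "w \<noteq> 0"
    by (simp add: w_def)
  have P: "P x v \<noteq> 0" for x v
    by (simp add: P_def)
  have nz: "x1 \<noteq> 0" "x2 \<noteq> 0" "v1 \<noteq> 0" "v2 \<noteq> 0"
    using xy v by auto
  have comb: "s *s x + t *s y \<noteq> 0" if "bracket x y \<noteq> 0" "(s, t) \<noteq> (0, 0)" for s t and x y :: "'a^2"
  proof
    assume "s *s x + t *s y = 0"
    then have "bracket (s *s x + t *s y) y = 0" "bracket x (s *s x + t *s y) = 0"
      by simp_all
    then show False
      using that by (simp add: bracket_add_left bracket_add_right)
  qed
  \<comment> \<open>\<open>s [x1, A v] + t [x2, A v]\<close> vanishes iff \<open>A\<close> maps \<open>v\<close> to the point \<open>s x1 + t x2\<close>.\<close>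
  have left: "P x1 v * bracket x2 (E *v v) = w * P x2 v * bracket x1 (F *v v)"
    if "v \<noteq> 0" "E \<in> T" "F \<in> T" "bracket x1 (E *v v) = 0" "bracket x2 (F *v v) = 0" for v E F
    unfolding P_def w_def
  proof (rule prod_nonzero_ratio[OF finite_T])
    show "\<exists>!A. A \<in> T \<and> s * bracket x1 (A *v v) + t * bracket x2 (A *v v) = 0"
      if "(s, t) \<noteq> (0, 0)" for s t
      using sharp[OF \<open>v \<noteq> 0\<close> comb[OF xy that]] by (simp add: bracket_add_left)
  qed (use that in auto)
  \<comment> \<open>\<open>s [x, A v1] + t [x, A v2]\<close> vanishes iff \<open>A\<close> maps the point \<open>s v1 + t v2\<close> to \<open>x\<close>.\<close>
  have right: "P x v1 * bracket x (E *v v2) = w * P x v2 * bracket x (F *v v1)"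
    if "x \<noteq> 0" "E \<in> T" "F \<in> T" "bracket x (E *v v1) = 0" "bracket x (F *v v2) = 0" for x E F
    unfolding P_def w_def
  proof (rule prod_nonzero_ratio[OF finite_T])
    show "\<exists>!A. A \<in> T \<and> s * bracket x (A *v v1) + t * bracket x (A *v v2) = 0"
      if "(s, t) \<noteq> (0, 0)" for s t
      using sharp[OF comb[OF v that] \<open>x \<noteq> 0\<close>]
      by (simp add: bracket_add_right matrix_vector_right_distrib vector_scalar_commute)
  qed (use that in auto)
  have 1: "P x1 v1 * bracket x2 (A *v v1) = w * P x2 v1 * bracket x1 (C *v v1)"
    by (rule left) (use nz T inc in auto)
  have 2: "P x1 v2 * bracket x2 (B *v v2) = w * P x2 v2 * bracket x1 (D *v v2)"
    by (rule left) (use nz T inc in auto)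
  have 3: "P x1 v1 * bracket x1 (A *v v2) = w * P x1 v2 * bracket x1 (B *v v1)"
    by (rule right) (use nz T inc in auto)
  have 4: "P x2 v1 * bracket x2 (C *v v2) = w * P x2 v2 * bracket x2 (D *v v1)"
    by (rule right) (use nz T inc in auto)
  let ?k = "P x1 v1 * P x1 v2 * P x2 v1 * P x2 v2 * w * w"
  have "(P x1 v1 * bracket x1 (A *v v2)) * (P x1 v2 * bracket x2 (B *v v2)) *
      (w * P x2 v1 * bracket x1 (C *v v1)) * (w * P x2 v2 * bracket x2 (D *v v1)) =
      (w * P x1 v2 * bracket x1 (B *v v1)) * (w * P x2 v2 * bracket x1 (D *v v2)) *
      (P x1 v1 * bracket x2 (A *v v1)) * (P x2 v1 * bracket x2 (C *v v2))"
    by (simp only: 1 2 3 4)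
  then have "?k * (bracket x1 (A *v v2) * bracket x2 (B *v v2) * bracket x1 (C *v v1) * bracket x2 (D *v v1)) =
    ?k * (bracket x2 (A *v v1) * bracket x1 (B *v v1) * bracket x2 (C *v v2) * bracket x1 (D *v v2))"
    by (simp only: mult_ac)
  moreover have "?k \<noteq> 0"
    using P w by simp
  ultimately show ?thesis
    using mult_left_cancel by blast
qed

text \<open>
  Put \<open>y = C x\<close> and \<open>z = B y\<close>. The four elements mapping \<open>x\<close> or \<open>y\<close> to \<open>y\<close> or \<open>z\<close> are \<open>C\<close>, \<open>1\<close>,
  \<open>A\<close> and \<open>B\<close>, and the relation between them turns into the equation of determinants, which
  means that \<open>\<alpha>\<close> is a double eigenvalue of \<open>(B C)\<^sup>-\<^sup>1 A\<close>. That \<open>B\<close> and \<open>C\<close> are not the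
  identity ensures that \<open>y, z\<close> and \<open>x, y\<close> are pairs of distinct points.
\<close>
lemma det_eq_if_agree_at_point:
  assumes T: "A \<in> T" "B \<in> T" "C \<in> T" and ne: "B \<noteq> mat 1" "C \<noteq> mat 1"
    and x: "x \<noteq> 0" and agree: "A *v x = \<alpha> *s ((B ** C) *v x)"
  shows "det A = \<alpha>\<^sup>2 * det (B ** C)"
proof -
  define y where "y = C *v x"
  define z where "z = B *v y"
  have "y \<noteq> 0"
    using no_fixed_point[OF T(3) ne(2) x] by (auto simp: y_def)
  then have yz: "bracket y z \<noteq> 0"
    using no_fixed_point[OF T(2) ne(1)] by (simp add: z_def)
  have xy: "bracket x y \<noteq> 0"
    using no_fixed_point[OF T(3) ne(2) x] by (simp add: y_def)
  have Ax: "A *v x = \<alpha> *s z"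
    using agree by (simp add: y_def z_def matrix_vector_mul_assoc)
  have "bracket y (C *v y) * bracket z (mat 1 *v y) * bracket y (A *v x) * bracket z (B *v x) =
    bracket z (C *v x) * bracket y (mat 1 *v x) * bracket z (A *v y) * bracket y (B *v y)"
    by (rule quadrilateral_relation[OF yz xy]) (use T one in \<open>auto simp: y_def Ax z_def[symmetric]\<close>,
      simp_all add: z_def y_def)
  moreover have "bracket y (C *v y) = det C * bracket x y"
    unfolding y_def by (rule bracket_matrix)
  moreover have "bracket z (B *v x) = det B * bracket y x"
    unfolding z_def by (rule bracket_matrix)
  ultimately have "(bracket y z * bracket y z * bracket x y) * (\<alpha> * det B * det C * bracket x y) =
      (bracket y z * bracket y z * bracket x y) * bracket z (A *v y)"
    by (simp add: Ax y_def[symmetric] z_def[symmetric] bracket_swap[of z y] bracket_swap[of y x] mult_ac)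
  then have *: "\<alpha> * det B * det C * bracket x y = bracket z (A *v y)"
    using xy yz by simp
  have "det A * bracket x y = \<alpha> * bracket z (A *v y)"
    using bracket_matrix[of A x y] by (simp add: Ax)
  also have "\<dots> = \<alpha>\<^sup>2 * det (B ** C) * bracket x y"
    by (simp add: *[symmetric] power2_eq_square det_mul mult_ac)
  finally show ?thesis
    using xy by simp
qed

text \<open>
  The determinant of \<open>(B C)\<^sup>-\<^sup>1 A\<close> is the product \<open>\<alpha> \<beta>\<close> of its eigenvalues, but also \<open>\<alpha>\<^sup>2\<close>.
\<close>
lemma proportional_if_agree_at_two_points:
  assumes T: "A \<in> T" "B \<in> T" "C \<in> T" and ne: "B \<noteq> mat 1" "C \<noteq> mat 1"
    and xy: "bracket x y \<noteq> 0"
    and x: "A *v x = \<alpha> *s ((B ** C) *v x)" and y: "A *v y = \<beta> *s ((B ** C) *v y)"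
  shows "A = mat \<alpha> ** (B ** C)"
proof -
  have "x \<noteq> 0"
    using xy by auto
  then have "\<alpha>\<^sup>2 * det (B ** C) = det A"
    using det_eq_if_agree_at_point[OF T ne _ x] by simp
  moreover have "det A * bracket x y = \<alpha> * \<beta> * det (B ** C) * bracket x y"
    unfolding bracket_matrix[of A x y, symmetric] x y by (simp add: bracket_matrix)
  moreover have "det A \<noteq> 0"
    using T by (simp add: det_nonzero)
  ultimately have "\<alpha> = \<beta>"
    using xy by (auto simp: power2_eq_square)
  then show ?thesis
    using x y by (intro matrix_eq_if_eq_on_basis[OF xy])
      (simp_all add: matrix_vector_mul_assoc[symmetric] mat_mult_vec)
qed

text \<open>
  Fixing a vector \<open>e\<close>, the points are parametrised by \<open>T\<close> via \<open>D \<mapsto> D e\<close>, so that the assignment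
  of an element agreeing with \<open>B C\<close> at a given point becomes a map from \<open>T\<close> to itself. If no
  element of \<open>T\<close> is a multiple of \<open>B C\<close>, this map is injective, hence surjective by finiteness.
  But \<open>B\<close> cannot agree with \<open>B C\<close> at any point, as \<open>C\<close> fixes none.
\<close>
lemma product_closed:
  assumes B: "B \<in> T" and C: "C \<in> T"
  obtains A c where "A \<in> T" "A = mat c ** (B ** C)"
proof -
  have "\<exists>A\<in>T. \<exists>c. A = mat c ** (B ** C)"
  proof (rule ccontr)
    assume not: "\<not> ?thesis"
    then have ne: "B \<noteq> mat 1" "C \<noteq> mat 1"
      using B C by (metis matrix_mul_lid matrix_mul_rid)+
    obtain e :: "'a^2" where e: "e \<noteq> 0"
      by (rule that[OF one_neq_zero])
    have nz: "A *v x \<noteq> 0" if "det A \<noteq> 0" "x \<noteq> 0" for A :: "'a^2^2" and x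
      using that by (metis invertible_det_nz PGL2_action_class(2))
    have BC: "det (B ** C) \<noteq> 0"
      using B C by (simp add: det_mul det_nonzero)
    have "\<exists>A. A \<in> T \<and> (\<exists>c. A *v x = c *s ((B ** C) *v x))" if "x \<noteq> 0" for x
      using sharp[OF that nz[OF BC that]] nz[OF BC that] by (metis bracket_eq_0D)
    then have "\<forall>D\<in>T. \<exists>A. A \<in> T \<and> (\<exists>c. A *v (D *v e) = c *s ((B ** C) *v (D *v e)))"
      using nz e det_nonzero by blast
    then obtain \<phi> where \<phi>: "\<And>D. D \<in> T \<Longrightarrow> \<phi> D \<in> T"
      "\<And>D. D \<in> T \<Longrightarrow> \<exists>c. \<phi> D *v (D *v e) = c *s ((B ** C) *v (D *v e))"
      by metis
    have "inj_on \<phi> T"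
    proof (rule inj_onI, rule ccontr)
      fix D E assume DE: "D \<in> T" "E \<in> T" "\<phi> D = \<phi> E" "D \<noteq> E"
      obtain c d where "\<phi> D *v (D *v e) = c *s ((B ** C) *v (D *v e))"
        "\<phi> D *v (E *v e) = d *s ((B ** C) *v (E *v e))"
        using \<phi>(2)[of D] \<phi>(2)[of E] DE by auto
      then have "\<phi> D = mat c ** (B ** C)"
        using proportional_if_agree_at_two_points[OF \<phi>(1)[OF DE(1)] B C ne
            independent_images[OF DE(1,2,4) e]] by blast
      then show False
        using not \<phi>(1)[OF DE(1)] by blast
    qed
    then have "\<phi> ` T = T"
      using \<phi>(1) by (auto intro!: endo_inj_surj[OF finite_T])
    then obtain D where D: "D \<in> T" "\<phi> D = B"
      using B by (metis imageE)
    define x where "x = D *v e"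
    have "x \<noteq> 0"
      using nz e det_nonzero D by (simp add: x_def)
    obtain c where "B *v x = c *s (B *v (C *v x))"
      using \<phi>(2)[OF D(1)] D(2) by (auto simp flip: x_def matrix_vector_mul_assoc)
    then have "bracket (B *v x) (B *v (C *v x)) = 0"
      by (metis bracket_scale_left bracket_self mult_zero_right)
    then have "bracket x (C *v x) = 0"
      using det_nonzero[OF B] by (simp add: bracket_matrix)
    then show False
      using no_fixed_point[OF C ne(2) \<open>x \<noteq> 0\<close>] by simp
  qed
  then show thesis
    using that by blast
qed

end

section \<open>From cosets and points to matrices and vectors\<close>

lemma proportional_class_eq_iff:
  assumes "x \<noteq> 0" "y \<noteq> 0"
  shows "proportional `` {x} = proportional `` {y} \<longleftrightarrow> bracket y x = 0"
proof -
  have "proportional `` {x} = proportional `` {y} \<longleftrightarrow> (y, x) \<in> proportional"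
    using assms eq_equiv_class_iff[OF equiv_proportional, of x y] equiv_proportional
    by (auto simp: equiv_def dest: symD)
  also have "\<dots> \<longleftrightarrow> bracket y x = 0"
  proof
    assume "bracket y x = 0"
    then obtain c where "x = c *s y"
      using assms(2) by (rule bracket_eq_0D)
    then show "(y, x) \<in> proportional"
      using assms by (auto simp: proportional_def)
  qed (auto simp: proportional_def)
  finally show ?thesis .
qed

lemma scalar_coset_absorb:
  assumes "c \<noteq> 0"
  shows "scalar_matrices #>\<^bsub>GL2\<^esub> (mat c ** A) = scalar_matrices #>\<^bsub>GL2\<^esub> A"
proof -
  have "scalar_matrices #>\<^bsub>GL2\<^esub> (mat c ** A) = {mat (d * c) ** A | d. d \<noteq> 0}"
    by (simp add: scalar_coset matrix_mul_assoc mat_mult_mat)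
  also have "\<dots> = {mat d ** A | d. d \<noteq> 0}"
  proof (intro equalityI subsetI)
    fix X assume "X \<in> {mat d ** A | d. d \<noteq> 0}"
    then obtain d where "d \<noteq> 0" "X = mat d ** A"
      by blast
    then have "d / c \<noteq> 0" "X = mat ((d / c) * c) ** A"
      using assms by auto
    then show "X \<in> {mat (d * c) ** A | d. d \<noteq> 0}"
      by blast
  qed (use assms in force)
  finally show ?thesis
    by (simp add: scalar_coset)
qed

theorem theorem1:
  fixes S :: "('a::{field,finite}^2^2) set set"
  assumes "S \<subseteq> carrier PGL2"
    and "sharply_transitive PGL2_action projective_line S"
    and "\<one>\<^bsub>PGL2\<^esub> \<in> S"
  shows "subgroup S PGL2"
proof -
  interpret G: group "PGL2 :: ('a^2^2) set monoid"
    by (rule group_PGL2)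
  let ?cls = "\<lambda>A :: 'a^2^2. scalar_matrices #>\<^bsub>GL2\<^esub> A"
  have one: "\<one>\<^bsub>PGL2\<^esub> = ?cls (mat 1)"
    by (simp add: PGL2_def scalar_coset) (simp add: scalar_matrices_def)
  have mult: "?cls A \<otimes>\<^bsub>PGL2\<^esub> ?cls B = ?cls (A ** B)" if "invertible A" "invertible B" for A B
    using that normal.rcos_sum[OF scalar_matrices_normal, of A B] by (simp add: PGL2_def GL2_def)
  have "\<forall>g\<in>S. \<exists>A. invertible A \<and> g = ?cls A \<and> (g = \<one>\<^bsub>PGL2\<^esub> \<longrightarrow> A = mat 1)"
  proof
    fix g assume "g \<in> S"
    then obtain A where "invertible A" "g = ?cls A"
      using assms(1) PGL2_cases by blast
    then show "\<exists>A. invertible A \<and> g = ?cls A \<and> (g = \<one>\<^bsub>PGL2\<^esub> \<longrightarrow> A = mat 1)"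
      using one by (cases "g = \<one>\<^bsub>PGL2\<^esub>") (auto simp: invertible_det_nz)
  qed
  then obtain R where R: "\<And>g. g \<in> S \<Longrightarrow> invertible (R g)" "\<And>g. g \<in> S \<Longrightarrow> g = ?cls (R g)"
    "R \<one>\<^bsub>PGL2\<^esub> = mat 1"
    using assms(3) by metis
  have action: "PGL2_action g (proportional `` {x}) = proportional `` {y} \<longleftrightarrow> bracket y (R g *v x) = 0"
    if "g \<in> S" "x \<noteq> 0" "y \<noteq> 0" for g x y
    using PGL2_action_class[OF R(1)[OF that(1)] that(2)] R(2)[OF that(1)] that
    by (metis proportional_class_eq_iff)
  interpret T: sharply_transitive_matrices "R ` S"
  proof
    show "det A \<noteq> 0" if "A \<in> R ` S" for A
      using that R(1) invertible_det_nz by auto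
    show "mat 1 \<in> R ` S"
      using R(3) assms(3) by force
    fix x y :: "'a^2" assume xy: "x \<noteq> 0" "y \<noteq> 0"
    then have "\<exists>!g. g \<in> S \<and> PGL2_action g (proportional `` {x}) = proportional `` {y}"
      using assms(2) by (simp add: sharply_transitive_def projective_lineI)
    then have "\<exists>!g. g \<in> S \<and> bracket y (R g *v x) = 0"
      using action xy by metis
    then obtain g where g: "g \<in> S" "bracket y (R g *v x) = 0"
      and uniq: "\<And>h. h \<in> S \<Longrightarrow> bracket y (R h *v x) = 0 \<Longrightarrow> h = g"
      by (elim ex1E) blast
    show "\<exists>!A. A \<in> R ` S \<and> bracket y (A *v x) = 0"
      by (rule ex1I[of _ "R g"]) (use g uniq in blast)+
  qed
  have closed: "g \<otimes>\<^bsub>PGL2\<^esub> h \<in> S" if gh: "g \<in> S" "h \<in> S" for g h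
  proof -
    obtain A c where A: "A \<in> R ` S" "A = mat c ** (R g ** R h)"
      by (rule T.product_closed[OF imageI[OF gh(1)] imageI[OF gh(2)]])
    then obtain k where k: "k \<in> S" "R k = mat c ** (R g ** R h)"
      by (metis imageE)
    then have "det (mat c :: 'a^2^2) \<noteq> 0"
      using R(1)[OF k(1)] by (simp add: invertible_det_nz det_mul)
    then have "c \<noteq> 0"
      by (auto simp: det_2 mat_def)
    then have "k = ?cls (R g ** R h)"
      using R(2)[OF k(1)] k(2) by (simp add: scalar_coset_absorb)
    also have "\<dots> = g \<otimes>\<^bsub>PGL2\<^esub> h"
      using mult R gh by metis
    finally show ?thesis
      using k(1) by simp
  qed
  show ?thesis
  proof (rule G.subgroupI)
    fix g assume g: "g \<in> S"
    obtain v :: "'a^2" where "v \<noteq> 0"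
      by (rule that[OF one_neq_zero])
    then obtain p :: "('a^2) set" where p: "p \<in> projective_line"
      using projective_lineI by blast
    have gp: "PGL2_action g p \<in> projective_line"
      using g p assms(1) PGL2_action_closed by blast
    then obtain h where h: "h \<in> S" "PGL2_action h (PGL2_action g p) = p"
      using assms(2) p unfolding sharply_transitive_def by blast
    have "PGL2_action (h \<otimes>\<^bsub>PGL2\<^esub> g) p = p" "PGL2_action \<one>\<^bsub>PGL2\<^esub> p = p"
      using h g p assms(1) by (simp_all add: subset_eq PGL2_action_mult PGL2_action_one)
    moreover have "\<exists>!k. k \<in> S \<and> PGL2_action k p = p"
      using assms(2) p unfolding sharply_transitive_def by simp
    ultimately have "h \<otimes>\<^bsub>PGL2\<^esub> g = \<one>\<^bsub>PGL2\<^esub>"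
      using assms(3) closed[OF h(1) g] by (elim ex1E) metis
    then have "inv\<^bsub>PGL2\<^esub> g = h"
      using h(1) g assms(1) by (intro G.inv_equality) auto
    then show "inv\<^bsub>PGL2\<^esub> g \<in> S"
      using h(1) by simp
  qed (use assms closed in auto)
qed

end
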